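(* Let $A=\mathbb{Z}[\rho]$ with $\rho=e^{2\pi i/6}$, and let $f$ be a primitive, integral, indefinite binary hermitian form over $\mathbb{Q}(\sqrt{-3})$ of discriminant $\Delta$, not representing $0$. Then there exists $\mathbf v\neq0$ in $A^2$ with $|f(\mathbf v)|\le\sqrt{\Delta/6}$. Moreover, equality $\min_{\mathbf v\in A^2\setminus\{0\}}|f(\mathbf v)|=\sqrt{\Delta/6}$ is achieved only for the unique $\mathrm{GL}_2(A)$-equivalence class of such forms of discriminant $6$.
   Context: $N(x)=|x|^2$. A binary hermitian form over $\mathbb{Q}(\sqrt{-3})$ is $f(x,y)=aN(x)+cN(y)+\nu x\bar y+\bar\nu\bar xy$ with $a,c\in\mathbb{Q}$, $\nu\in\mathbb{Q}(\sqrt{-3})$; integral means $f(A^2)\subseteq\mathbb{Z}$; primitive means the values $f(\mathbf w)$, $\mathbf w\in A^2$, have greatest common divisor $1$; indefinite means it takes both signs; not representing $0$ means $f(\mathbf w)\neq0$ for all non-zero $\mathbf w\in A^2$. The discriminant is $\Delta=-3(ac-N(\nu))$ computed from the matrix $\begin{pmatrix}a&\nu\\ \bar\nu&c\end{pmatrix}$ of $f$ in a basis of $A^2$ (independent of that basis); $\Delta>0$ for indefinite forms. Forms $f,f'$ are $\mathrm{GL}_2(A)$-equivalent if $f'(\mathbf w)=f(g\mathbf w)$ for some $g\in\mathrm{GL}_2(A)$ and all $\mathbf w$. *)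

theory Defs
  imports "HOL-Analysis.Analysis" "HOL-Computational_Algebra.Polynomial"
begin

definition rho :: complex where
  "rho = exp (2 * of_real pi * \<i> / 6)"

definition eisenstein :: "complex set" where
  "eisenstein = range (\<lambda>p :: int poly. poly (map_poly of_int p) rho)"

definition Q_sqrt_m3 :: "complex set" where
  "Q_sqrt_m3 = {of_rat p + of_rat q * csqrt (-3) | p q. True}"

definition lattice2 :: "(complex ^ 2) set" where
  "lattice2 = {v. \<forall>i. v $ i \<in> eisenstein}"

definition GL2 :: "(complex ^ 2 ^ 2) set" where
  "GL2 = {g. (\<forall>i j. g $ i $ j \<in> eisenstein) \<and>
     (\<exists>h. (\<forall>i j. h $ i $ j \<in> eisenstein) \<and> g ** h = mat 1 \<and> h ** g = mat 1)}"

text \<open>The coefficients of the form, that is, the hermitian matrix with rows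
  \<open>(a, \<nu>)\<close> and \<open>(cnj \<nu>, c)\<close>. The condition that \<open>\<nu>\<close> lies in the quadratic field is
  imposed by \<open>herm_forms\<close>.\<close>

record herm_form =
  coef_a :: rat
  coef_c :: rat
  coef_nu :: complex

definition herm_forms :: "herm_form set" where
  "herm_forms = {f. coef_nu f \<in> Q_sqrt_m3}"

text \<open>The argument of \<open>Re\<close> is always real.\<close>

definition hval :: "herm_form \<Rightarrow> complex ^ 2 \<Rightarrow> real" where
  "hval f v = of_rat (coef_a f) * (cmod (v $ 1))\<^sup>2 + of_rat (coef_c f) * (cmod (v $ 2))\<^sup>2
     + Re (coef_nu f * v $ 1 * cnj (v $ 2) + cnj (coef_nu f) * cnj (v $ 1) * v $ 2)"

definition disc :: "herm_form \<Rightarrow> real" where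
  "disc f = - 3 * (of_rat (coef_a f) * of_rat (coef_c f) - (cmod (coef_nu f))\<^sup>2)"

definition integral_form :: "herm_form \<Rightarrow> bool" where
  "integral_form f \<longleftrightarrow> (\<forall>w\<in>lattice2. hval f w \<in> \<int>)"

text \<open>Intended for integral forms only: non-integral values would be ignored.\<close>

definition primitive_form :: "herm_form \<Rightarrow> bool" where
  "primitive_form f \<longleftrightarrow> Gcd {n :: int. \<exists>w\<in>lattice2. hval f w = of_int n} = 1"

definition indefinite_form :: "herm_form \<Rightarrow> bool" where
  "indefinite_form f \<longleftrightarrow> (\<exists>v\<in>lattice2. hval f v > 0) \<and> (\<exists>w\<in>lattice2. hval f w < 0)"

definition represents_zero :: "herm_form \<Rightarrow> bool" where
  "represents_zero f \<longleftrightarrow> (\<exists>w\<in>lattice2 - {0}. hval f w = 0)"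

definition admissible_forms :: "herm_form set" where
  "admissible_forms = {f \<in> herm_forms. integral_form f \<and> primitive_form f \<and>
     indefinite_form f \<and> \<not> represents_zero f}"

definition GL2_equiv :: "(herm_form \<times> herm_form) set" where
  "GL2_equiv = {(f, f'). f \<in> herm_forms \<and> f' \<in> herm_forms \<and>
     (\<exists>g\<in>GL2. \<forall>w\<in>lattice2. hval f' w = hval f (g *v w))}"

definition is_min_abs :: "herm_form \<Rightarrow> real \<Rightarrow> bool" where
  "is_min_abs f m \<longleftrightarrow> (\<exists>v\<in>lattice2 - {0}. \<bar>hval f v\<bar> = m) \<and>
     (\<forall>v\<in>lattice2 - {0}. m \<le> \<bar>hval f v\<bar>)"

end

theory Submission imports Defs begin

text \<open>Let \<open>m\<close> be the least non-zero absolute value of \<open>f\<close>. A vector attaining it is unimodular, so up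
  to sign and a change of basis \<open>f\<close> has first coefficient \<open>m\<close>, and on the line \<open>y = 1\<close> it is
  \<open>m |z|\<^sup>2 - D / m\<close> with \<open>D = \<Delta> / 3\<close> and \<open>z\<close> in a coset of \<open>A\<close>. No point of that coset lies in the
  open annulus \<open>D / m\<^sup>2 - 1 < |z|\<^sup>2 < D / m\<^sup>2 + 1\<close>. Stepping by units from the outermost coset point
  inside the annulus forces \<open>|z| \<ge> 1\<close> there, hence \<open>D \<ge> 2 m\<^sup>2\<close>; if equality holds, that point
  is a unit, the coset is \<open>A\<close> itself, and \<open>f\<close> is equivalent to \<open>\<plusminus>m (N x - 2 N y)\<close>. Primitivity
  gives \<open>m = 1\<close>, and \<open>N x - 2 N y\<close> is equivalent to its negative.\<close>

section \<open>Eisenstein integers\<close>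

lemma rho_eq: "rho = Complex (1/2) (sqrt 3 / 2)"
proof -
  have "2 * complex_of_real pi * \<i> / 6 = \<i> * of_real (pi / 3)" by simp
  then show ?thesis
    by (simp only: rho_def cis_conv_exp[symmetric]) (simp add: complex_eq_iff cos_60 sin_60)
qed

lemma rho_squared: "rho * rho = rho - 1"
  by (simp add: rho_eq complex_eq_iff)

text \<open>The relation \<open>rho * rho = rho - 1\<close> reduces every integer polynomial in
  \<open>rho\<close> to degree at most one.\<close>

lemma eisenstein_eq: "eisenstein = {of_int p + of_int q * rho | p q. True}"
proof (intro equalityI subsetI)
  fix x assume "x \<in> eisenstein"
  then obtain P :: "int poly" where x: "x = poly (map_poly of_int P) rho"
    by (auto simp: eisenstein_def)
  have "\<exists>p q :: int. poly (map_poly of_int P) rho = of_int p + of_int q * rho"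
  proof (induction P)
    case 0
    have "poly (map_poly of_int (0 :: int poly)) rho = of_int 0 + of_int 0 * rho" by simp
    then show ?case by blast
  next
    case (pCons k P)
    then obtain p q :: int where "poly (map_poly of_int P) rho = of_int p + of_int q * rho"
      by blast
    then have "poly (map_poly of_int (pCons k P)) rho
        = of_int k + of_int p * rho + of_int q * (rho * rho)"
      by (simp add: map_poly_pCons algebra_simps)
    also have "\<dots> = of_int (k - q) + of_int (p + q) * rho"
      by (simp add: rho_squared algebra_simps)
    finally show ?case by blast
  qed
  then show "x \<in> {of_int p + of_int q * rho | p q. True}" using x by blast
next
  fix x assume "x \<in> {of_int p + of_int q * rho | p q. True}"
  then obtain p q :: int where "x = of_int p + of_int q * rho" by blast
  then have "x = poly (map_poly of_int [:p, q:]) rho"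
    by (simp add: map_poly_pCons algebra_simps)
  then show "x \<in> eisenstein" unfolding eisenstein_def by blast
qed

lemma eisenstein_of_int [simp]: "of_int k \<in> eisenstein"
proof -
  have "of_int k = of_int k + of_int 0 * rho" by simp
  then show ?thesis unfolding eisenstein_eq by blast
qed

lemma eisenstein_0 [simp]: "0 \<in> eisenstein"
  and eisenstein_1 [simp]: "1 \<in> eisenstein"
  and eisenstein_numeral [simp]: "numeral n \<in> eisenstein"
  using eisenstein_of_int[of 0] eisenstein_of_int[of 1] eisenstein_of_int[of "numeral n"]
  by simp_all

lemma rho_in_eisenstein [simp]: "rho \<in> eisenstein"
proof -
  have "rho = of_int 0 + of_int 1 * rho" by simp
  then show ?thesis unfolding eisenstein_eq by blast
qed

lemma eisenstein_add [simp]: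
  assumes "x \<in> eisenstein" "y \<in> eisenstein"
  shows "x + y \<in> eisenstein"
proof -
  obtain p q r s :: int where "x = of_int p + of_int q * rho" "y = of_int r + of_int s * rho"
    using assms unfolding eisenstein_eq by blast
  then have "x + y = of_int (p + r) + of_int (q + s) * rho" by (simp add: algebra_simps)
  then show ?thesis unfolding eisenstein_eq by blast
qed

lemma eisenstein_uminus [simp]:
  assumes "x \<in> eisenstein"
  shows "- x \<in> eisenstein"
proof -
  obtain p q :: int where "x = of_int p + of_int q * rho"
    using assms unfolding eisenstein_eq by blast
  then have "- x = of_int (- p) + of_int (- q) * rho" by (simp add: algebra_simps)
  then show ?thesis unfolding eisenstein_eq by blast
qed

lemma eisenstein_diff [simp]:
  "x \<in> eisenstein \<Longrightarrow> y \<in> eisenstein \<Longrightarrow> x - y \<in> eisenstein"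
  using eisenstein_add[of x "- y"] by simp

lemma eisenstein_mult [simp]:
  assumes "x \<in> eisenstein" "y \<in> eisenstein"
  shows "x * y \<in> eisenstein"
proof -
  obtain p q r s :: int where xy: "x = of_int p + of_int q * rho" "y = of_int r + of_int s * rho"
    using assms unfolding eisenstein_eq by blast
  have "x * y = of_int (p * r) + of_int (p * s + q * r) * rho + of_int (q * s) * (rho * rho)"
    by (simp add: xy algebra_simps)
  also have "\<dots> = of_int (p * r - q * s) + of_int (p * s + q * r + q * s) * rho"
    by (simp add: rho_squared algebra_simps)
  finally show ?thesis unfolding eisenstein_eq by blast
qed

text \<open>Real coefficients make the formula available off the lattice, for rounding errors and
  coset points.\<close>

lemma cmod_squared_rho: "(cmod (of_real p + of_real q * rho))\<^sup>2 = p\<^sup>2 + p * q + q\<^sup>2"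
  by (simp add: cmod_power2 rho_eq) (simp add: power2_eq_square algebra_simps)

lemma eisenstein_norm_int:
  "(cmod (of_int p + of_int q * rho))\<^sup>2 = of_int (p\<^sup>2 + p * q + q\<^sup>2)"
  using cmod_squared_rho[of "of_int p" "of_int q"] by simp

lemma eisenstein_norm_Ints: "x \<in> eisenstein \<Longrightarrow> (cmod x)\<^sup>2 \<in> \<int>"
  unfolding eisenstein_eq by (auto simp only: eisenstein_norm_int Ints_of_int)

section \<open>Euclidean division in the Eisenstein integers\<close>

lemma complex_rho_coordinates: obtains p q :: real where "z = of_real p + of_real q * rho"
proof -
  have "z = of_real (Re z - Im z / sqrt 3) + of_real (2 * Im z / sqrt 3) * rho"
    by (simp add: complex_eq_iff rho_eq field_simps)
  then show ?thesis by (rule that)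
qed

text \<open>Rounding both coordinates in the basis \<open>1\<close>, \<open>rho\<close> leaves
  errors of at most 1/2, hence a remainder of norm at most 3/4.\<close>

lemma eisenstein_approx:
  obtains e where "e \<in> eisenstein" "(cmod (z - e))\<^sup>2 < 1"
proof -
  obtain p q where z: "z = of_real p + of_real q * rho" by (rule complex_rho_coordinates)
  define s where "s = p - of_int (round p)"
  define t where "t = q - of_int (round q)"
  have st: "\<bar>s\<bar> \<le> 1/2" "\<bar>t\<bar> \<le> 1/2"
    using of_int_round_abs_le[of p] of_int_round_abs_le[of q] by (simp_all add: s_def t_def abs_minus_commute)
  have "\<bar>s\<bar> * \<bar>s\<bar> \<le> 1/2 * (1/2)" "\<bar>s\<bar> * \<bar>t\<bar> \<le> 1/2 * (1/2)" "\<bar>t\<bar> * \<bar>t\<bar> \<le> 1/2 * (1/2)"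
    using st by (intro mult_mono; simp)+
  moreover have "s * t \<le> \<bar>s\<bar> * \<bar>t\<bar>" by (metis abs_ge_self abs_mult)
  ultimately have "s\<^sup>2 + s * t + t\<^sup>2 < 1" by (simp add: power2_eq_square)
  moreover have "z - (of_int (round p) + of_int (round q) * rho) = of_real s + of_real t * rho"
    by (simp add: z s_def t_def algebra_simps)
  ultimately have "(cmod (z - (of_int (round p) + of_int (round q) * rho)))\<^sup>2 < 1"
    by (simp only: cmod_squared_rho)
  then show ?thesis by (intro that) auto
qed

text \<open>The element of least positive norm in the ideal generated by \<open>x\<close> and \<open>y\<close> generates it.\<close>

lemma eisenstein_bezout:
  assumes xy: "x \<in> eisenstein" "y \<in> eisenstein" and nz: "x \<noteq> 0 \<or> y \<noteq> 0"
  obtains d s t x' y' where "d \<noteq> 0" "d \<in> eisenstein" "s \<in> eisenstein" "t \<in> eisenstein"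
    "x' \<in> eisenstein" "y' \<in> eisenstein" "x = d * x'" "y = d * y'" "s * x' + t * y' = 1"
proof -
  define I where "I = {s * x + t * y | s t. s \<in> eisenstein \<and> t \<in> eisenstein}"
  have "x = 1 * x + 0 * y" "y = 0 * x + 1 * y" by simp_all
  then have xI: "x \<in> I" and yI: "y \<in> I"
    unfolding I_def using eisenstein_0 eisenstein_1 by blast+
  have I_sub: "I \<subseteq> eisenstein" using xy by (auto simp: I_def)
  have I_comb: "u - e * d \<in> I" if ud: "u \<in> I" "d \<in> I" and e: "e \<in> eisenstein" for u d e
  proof -
    obtain s t s' t' where h: "u = s * x + t * y" "d = s' * x + t' * y" "s \<in> eisenstein"
      "t \<in> eisenstein" "s' \<in> eisenstein" "t' \<in> eisenstein" using ud unfolding I_def by blast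
    then have "u - e * d = (s - e * s') * x + (t - e * t') * y" by (simp add: algebra_simps)
    moreover have "s - e * s' \<in> eisenstein" "t - e * t' \<in> eisenstein" using h e by simp_all
    ultimately show ?thesis unfolding I_def by blast
  qed
  obtain d0 where "d0 \<in> I \<and> d0 \<noteq> 0" using xI yI nz by blast
  from ex_has_least_nat[where m = "\<lambda>d. nat \<lfloor>(cmod d)\<^sup>2\<rfloor>" and P = "\<lambda>d. d \<in> I \<and> d \<noteq> 0", OF this]
  obtain d where d: "d \<in> I" "d \<noteq> 0"
    and dmin: "\<And>e. e \<in> I \<Longrightarrow> e \<noteq> 0 \<Longrightarrow> nat \<lfloor>(cmod d)\<^sup>2\<rfloor> \<le> nat \<lfloor>(cmod e)\<^sup>2\<rfloor>"
    by metis
  \<comment> \<open>Norms of Eisenstein integers are non-negative integers, so \<open>nat\<close>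
    and floor lose nothing.\<close>
  have dmin': "(cmod d)\<^sup>2 \<le> (cmod e)\<^sup>2" if e: "e \<in> I" "e \<noteq> 0" for e
  proof -
    obtain k l :: int where "(cmod d)\<^sup>2 = of_int k" "(cmod e)\<^sup>2 = of_int l"
      using eisenstein_norm_Ints d(1) e(1) I_sub by (metis Ints_cases subsetD)
    moreover from this have "0 \<le> k" "0 \<le> l"
      by (metis of_int_0_le_iff zero_le_power2)+
    ultimately show ?thesis using dmin[OF e] by simp
  qed
  have dvd: "\<exists>u'\<in>eisenstein. u = d * u'" if "u \<in> I" for u
  proof -
    \<comment> \<open>Euclidean division: the remainder lies in \<open>I\<close> and has smaller
      norm than \<open>d\<close>, so it vanishes.\<close>
    obtain e where e: "e \<in> eisenstein" "(cmod (u / d - e))\<^sup>2 < 1" by (rule eisenstein_approx)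
    have "u - e * d = (u / d - e) * d" using d by (simp add: field_simps)
    then have "(cmod (u - e * d))\<^sup>2 = (cmod (u / d - e))\<^sup>2 * (cmod d)\<^sup>2"
      by (simp add: norm_mult power_mult_distrib)
    also have "\<dots> < 1 * (cmod d)\<^sup>2" using e d by (intro mult_strict_right_mono) auto
    finally have "u - e * d = 0"
      using dmin'[OF I_comb[OF that d(1) e(1)]] by (metis mult_1 not_less)
    then show ?thesis using e(1) by (auto intro!: bexI[of _ e] simp: mult.commute)
  qed
  obtain x' y' where x': "x' \<in> eisenstein" "x = d * x'" and y': "y' \<in> eisenstein" "y = d * y'"
    using dvd[OF xI] dvd[OF yI] by blast
  obtain s t where st: "d = s * x + t * y" "s \<in> eisenstein" "t \<in> eisenstein"
    using d(1) by (auto simp: I_def)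
  have "d * (s * x' + t * y') = s * (d * x') + t * (d * y')" by (simp add: algebra_simps)
  also have "\<dots> = d * 1" unfolding x'(2)[symmetric] y'(2)[symmetric] st(1)[symmetric] by simp
  finally have "s * x' + t * y' = 1" using d(2) by (metis mult_left_cancel)
  then show ?thesis using that d I_sub st x' y' by blast
qed

text \<open>Among \<open>A\<close>, \<open>B\<close> and \<open>- A - B\<close> two have the same sign, so the third is at least 2 in
  absolute value.\<close>

lemma sum_squares_hexagon:
  fixes A B :: real
  assumes "1 \<le> \<bar>A\<bar>" "1 \<le> \<bar>B\<bar>" "1 \<le> \<bar>A + B\<bar>"
  shows "6 \<le> A\<^sup>2 + B\<^sup>2 + (A + B)\<^sup>2"
    and "A\<^sup>2 + B\<^sup>2 + (A + B)\<^sup>2 \<le> 6 \<Longrightarrow>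
      (A = 1 \<and> B = 1) \<or> (A = -1 \<and> B = -1) \<or> (A = 2 \<and> B = -1) \<or> (A = -2 \<and> B = 1)
        \<or> (A = 1 \<and> B = -2) \<or> (A = -1 \<and> B = 2)"
proof -
  \<comment> \<open>Tangents to the parabola at 1, -1, 2 and -2 reduce both claims to linear
    arithmetic over the sign cases.\<close>
  have sq: "2 * t - 1 \<le> t\<^sup>2" "- 2 * t - 1 \<le> t\<^sup>2" "4 * t - 4 \<le> t\<^sup>2" "- 4 * t - 4 \<le> t\<^sup>2" for t :: real
    using zero_le_power2[of "t - 1"] zero_le_power2[of "t + 1"] zero_le_power2[of "t - 2"]
      zero_le_power2[of "t + 2"] by (simp_all add: power2_eq_square algebra_simps)
  show "6 \<le> A\<^sup>2 + B\<^sup>2 + (A + B)\<^sup>2"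
    using assms sq[of A] sq[of B] sq[of "A + B"] by (smt (verit))
  show "(A = 1 \<and> B = 1) \<or> (A = -1 \<and> B = -1) \<or> (A = 2 \<and> B = -1) \<or> (A = -2 \<and> B = 1)
        \<or> (A = 1 \<and> B = -2) \<or> (A = -1 \<and> B = 2)" if "A\<^sup>2 + B\<^sup>2 + (A + B)\<^sup>2 \<le> 6"
    using that assms sq[of A] sq[of B] sq[of "A + B"] by (smt (verit))
qed

text \<open>The units come in pairs \<open>u\<close>, \<open>- u\<close>, so three of them suffice
  under the absolute value. Since \<open>rho = 1 + (rho - 1)\<close>, the traces for
  \<open>1\<close>, \<open>rho - 1\<close> and \<open>rho\<close> are \<open>A\<close>,
  \<open>B\<close> and \<open>A + B\<close>, and their squares add up to six times the norm of
  \<open>z\<close>. Equality leaves exactly the six units.\<close>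

lemma hexagon_separation:
  assumes u: "\<And>u. u \<in> {1, rho, rho - 1} \<Longrightarrow> 1 \<le> \<bar>2 * Re (z * cnj u)\<bar>"
  shows "1 \<le> (cmod z)\<^sup>2" and "(cmod z)\<^sup>2 \<le> 1 \<Longrightarrow> z \<in> eisenstein"
proof -
  obtain p q where z: "z = of_real p + of_real q * rho" by (rule complex_rho_coordinates)
  define A where "A = 2 * p + q"
  define B where "B = q - p"
  have A: "1 \<le> \<bar>A\<bar>" using u[of 1] by (simp add: z A_def rho_eq algebra_simps)
  have AB: "1 \<le> \<bar>A + B\<bar>" using u[of rho] by (simp add: z A_def B_def rho_eq algebra_simps)
  have B: "1 \<le> \<bar>B\<bar>" using u[of "rho - 1"] by (simp add: z B_def rho_eq algebra_simps)
  have N: "6 * (cmod z)\<^sup>2 = A\<^sup>2 + B\<^sup>2 + (A + B)\<^sup>2"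
    unfolding z cmod_squared_rho by (simp add: A_def B_def power2_eq_square algebra_simps)
  have pq: "p = (A - B) / 3" "q = (A + 2 * B) / 3" by (simp_all add: A_def B_def)
  note hex = sum_squares_hexagon[OF A B AB]
  show "1 \<le> (cmod z)\<^sup>2" using hex(1) N by linarith
  assume "(cmod z)\<^sup>2 \<le> 1"
  then have "A\<^sup>2 + B\<^sup>2 + (A + B)\<^sup>2 \<le> 6" using N by linarith
  from hex(2)[OF this]
  have "(p = 0 \<and> q = 1) \<or> (p = 0 \<and> q = -1) \<or> (p = 1 \<and> q = 0) \<or> (p = -1 \<and> q = 0)
      \<or> (p = 1 \<and> q = -1) \<or> (p = -1 \<and> q = 1)"
    using pq by (elim disjE conjE) simp_all
  then show "z \<in> eisenstein" by (auto simp: z)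
qed

section \<open>Hermitian forms with real diagonal\<close>

text \<open>Real \<open>a\<close> and \<open>c\<close> let base changes and sign changes stay in
  this family without tracking rationality.\<close>

definition herm :: "real \<Rightarrow> real \<Rightarrow> complex \<Rightarrow> complex \<Rightarrow> complex \<Rightarrow> real" where
  "herm a c \<nu> x y = a * (cmod x)\<^sup>2 + c * (cmod y)\<^sup>2 + 2 * Re (\<nu> * x * cnj y)"

text \<open>The sesquilinear form belonging to \<open>herm a c \<nu>\<close>, at the vectors (p, r)
  and (q, s), which serve as the columns of a matrix.\<close>

definition herm_polar :: "real \<Rightarrow> real \<Rightarrow> complex \<Rightarrow> complex \<Rightarrow> complex \<Rightarrow> complex \<Rightarrow> complex \<Rightarrow> complex" where
  "herm_polar a c \<nu> p r q s =
     of_real a * p * cnj q + of_real c * r * cnj s + \<nu> * p * cnj s + cnj \<nu> * cnj q * r"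

text \<open>Over the complex numbers the form is a polynomial in the variables and their conjugates,
  so the identities below become plain algebra.\<close>

lemma of_real_herm:
  "complex_of_real (herm a c \<nu> x y) = of_real a * (x * cnj x) + of_real c * (y * cnj y)
     + \<nu> * x * cnj y + cnj \<nu> * cnj x * y"
proof -
  have "complex_of_real (2 * Re (\<nu> * x * cnj y)) = \<nu> * x * cnj y + cnj (\<nu> * x * cnj y)"
    by (simp only: complex_add_cnj)
  then show ?thesis
    unfolding herm_def of_real_add of_real_mult[of a] of_real_mult[of c] complex_norm_square
    by simp
qed

lemma herm_subst:
  "herm a c \<nu> (p * x + q * y) (r * x + s * y) =
   herm (herm a c \<nu> p r) (herm a c \<nu> q s) (herm_polar a c \<nu> p r q s) x y"
  unfolding of_real_eq_iff[where 'a = complex, symmetric] of_real_herm herm_polar_def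
  by (simp add: algebra_simps)

text \<open>Multiplicativity of determinants for the Gram matrix of the two columns, with the sign
  reversed to match the discriminant.\<close>

lemma herm_det_subst:
  "(cmod (herm_polar a c \<nu> p r q s))\<^sup>2 - herm a c \<nu> p r * herm a c \<nu> q s
     = ((cmod \<nu>)\<^sup>2 - a * c) * (cmod (p * s - q * r))\<^sup>2"
  unfolding of_real_eq_iff[where 'a = complex, symmetric]
  unfolding of_real_diff of_real_mult of_real_herm complex_norm_square herm_polar_def
  by (simp add: algebra_simps)

text \<open>The vectors (1, 1) and (rho, 1) reveal the real parts of \<open>\<nu>\<close> and
  \<open>\<nu> * rho\<close>, which determine \<open>\<nu>\<close> because \<open>1\<close> and
  \<open>rho\<close> are independent over the reals.\<close>

lemma herm_coeffs_eqI:
  assumes "\<And>x y. x \<in> eisenstein \<Longrightarrow> y \<in> eisenstein \<Longrightarrow> herm a c \<nu> x y = herm a' c' \<nu>' x y"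
  shows "a = a'" "c = c'" "\<nu> = \<nu>'"
proof -
  show a: "a = a'" using assms[of 1 0] by (simp add: herm_def)
  show c: "c = c'" using assms[of 0 1] by (simp add: herm_def)
  have "Re \<nu> = Re \<nu>'" using assms[of 1 1] by (simp add: herm_def a c)
  moreover have "Re (\<nu> * rho) = Re (\<nu>' * rho)" using assms[of rho 1] by (simp add: herm_def a c)
  ultimately show "\<nu> = \<nu>'" by (simp add: complex_eq_iff rho_eq)
qed

lemma herm_complete_square:
  "a * herm a c \<nu> x y = (cmod (of_real a * x + cnj \<nu> * y))\<^sup>2 - ((cmod \<nu>)\<^sup>2 - a * c) * (cmod y)\<^sup>2"
  unfolding of_real_eq_iff[where 'a = complex, symmetric]
  unfolding of_real_diff of_real_mult of_real_herm complex_norm_square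
  by (simp add: algebra_simps)

text \<open>On the line \<open>y = 1\<close> the form is \<open>a |z|\<^sup>2 - D / a\<close>, where \<open>z\<close> runs through a coset of the
  Eisenstein integers and \<open>D\<close> is minus the determinant. At the point where it takes its largest
  negative value, a step by a unit \<open>u\<close> changes it by \<open>a (1 + 2 Re (z cnj u))\<close>, and this cannot lie
  strictly between \<open>0\<close> and \<open>2 a\<close>.\<close>

lemma herm_min_bound:
  fixes a c :: real and \<nu> :: complex
  defines "D \<equiv> (cmod \<nu>)\<^sup>2 - a * c"
  assumes a: "a > 0"
    and int: "\<And>x y. x \<in> eisenstein \<Longrightarrow> y \<in> eisenstein \<Longrightarrow> herm a c \<nu> x y \<in> \<int>"
    and min: "\<And>x y. x \<in> eisenstein \<Longrightarrow> y \<in> eisenstein \<Longrightarrow> x \<noteq> 0 \<or> y \<noteq> 0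
                 \<Longrightarrow> a \<le> \<bar>herm a c \<nu> x y\<bar>"
    and neg: "herm a c \<nu> x0 y0 < 0"
  shows "2 * a\<^sup>2 \<le> D" and "D = 2 * a\<^sup>2 \<Longrightarrow> cnj \<nu> / of_real a \<in> eisenstein"
proof -
  \<comment> \<open>For non-positive \<open>D\<close> the completed square would make
    \<open>a\<close> times the form non-negative everywhere.\<close>
  have D: "D > 0"
  proof (rule ccontr)
    assume "\<not> D > 0"
    then have "D * (cmod y0)\<^sup>2 \<le> 0" by (simp add: mult_nonpos_nonneg)
    then have "a * herm a c \<nu> x0 y0 \<ge> 0"
      unfolding herm_complete_square D_def[symmetric] by (smt (verit) zero_le_power2)
    then show False using a neg by (simp add: zero_le_mult_iff)
  qed
  define z where "z x = x + cnj \<nu> / of_real a" for x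
  define h where "h x = herm a c \<nu> x 1" for x
  have h: "h x = a * (cmod (z x))\<^sup>2 - D / a" for x
  proof -
    have "of_real a * x + cnj \<nu> * 1 = of_real a * z x" using a by (simp add: z_def field_simps)
    then have "a * h x = a\<^sup>2 * (cmod (z x))\<^sup>2 - D"
      unfolding h_def herm_complete_square D_def by (simp add: norm_mult power_mult_distrib)
    then show ?thesis using a by (simp add: field_simps power2_eq_square)
  qed
  have h_min: "a \<le> \<bar>h x\<bar>" if "x \<in> eisenstein" for x
    unfolding h_def by (rule min) (simp_all add: that)
  \<comment> \<open>Rounding gives a coset point of norm below 1. There the form is less than
    \<open>a\<close>, so minimality pushes it down to at most \<open>- a\<close>.\<close>
  obtain e where e: "e \<in> eisenstein" "(cmod (cnj \<nu> / of_real a - e))\<^sup>2 < 1" by (rule eisenstein_approx)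
  have "(cmod (z (- e)))\<^sup>2 < 1" using e(2) by (simp add: z_def add.commute)
  then have "a * (cmod (z (- e)))\<^sup>2 < a" using a by simp
  moreover have "D / a > 0" using D a by simp
  ultimately have "h (- e) < a" unfolding h by linarith
  then have "- e \<in> eisenstein \<and> h (- e) \<le> - a" using e(1) h_min[of "- e"] by auto
  \<comment> \<open>Minimising \<open>- h\<close> picks the negative value closest to 0; the values
    are integers, so the truncation is exact.\<close>
  from ex_has_least_nat[where m = "\<lambda>x. nat \<lfloor>- h x\<rfloor>" and P = "\<lambda>x. x \<in> eisenstein \<and> h x \<le> - a", OF this]
  obtain x where x: "x \<in> eisenstein" "h x \<le> - a"
    and least: "\<And>y. y \<in> eisenstein \<Longrightarrow> h y \<le> - a \<Longrightarrow> nat \<lfloor>- h x\<rfloor> \<le> nat \<lfloor>- h y\<rfloor>" by blast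
  have jump: "a \<le> h y" if y: "y \<in> eisenstein" "h x < h y" for y
  proof (rule ccontr)
    assume "\<not> a \<le> h y"
    then have hy: "h y \<le> - a" using h_min[OF y(1)] by linarith
    obtain k l :: int where "h x = of_int k" "h y = of_int l"
      unfolding h_def using int x(1) y(1) by (metis Ints_cases eisenstein_1)
    then show False using least[OF y(1) hy] y(2) hy a x(2) by simp
  qed
  have step: "1 \<le> \<bar>2 * Re (z x * cnj u)\<bar>" if "u \<in> {1, rho, rho - 1}" for u
  proof (rule ccontr)
    assume *: "\<not> 1 \<le> \<bar>2 * Re (z x * cnj u)\<bar>"
    have u: "u \<in> eisenstein" "(cmod u)\<^sup>2 = 1"
      using that by (auto simp: cmod_power2) (auto simp: rho_eq power2_eq_square)
    have "z (x + u) = z x + u" by (simp add: z_def)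
    then have "(cmod (z (x + u)))\<^sup>2 = (cmod (z x))\<^sup>2 + 1 + 2 * Re (z x * cnj u)"
      using u(2) unfolding cmod_power2 by (simp add: power2_eq_square algebra_simps)
    then have hu: "h (x + u) = h x + a * (1 + 2 * Re (z x * cnj u))"
      unfolding h by (simp add: algebra_simps)
    have "0 < a * (1 + 2 * Re (z x * cnj u))" using * a by (intro mult_pos_pos) auto
    then have "a \<le> h (x + u)" using jump[of "x + u"] x u hu by simp
    moreover have "a * (1 + 2 * Re (z x * cnj u)) < a * 2" using * a by (intro mult_strict_left_mono) auto
    ultimately show False using hu x(2) by linarith
  qed
  \<comment> \<open>Multiplying \<open>h x \<le> - a\<close> by \<open>a\<close> clears the
    denominator and bounds \<open>D\<close> from below by the norm of \<open>z x\<close>.\<close>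
  have "a * (a * (cmod (z x))\<^sup>2 - D / a) \<le> a * (- a)"
    using x(2) a unfolding h by (intro mult_left_mono) auto
  then have *: "a\<^sup>2 * (1 + (cmod (z x))\<^sup>2) \<le> D" using a by (simp add: power2_eq_square algebra_simps)
  have "a\<^sup>2 * 2 \<le> a\<^sup>2 * (1 + (cmod (z x))\<^sup>2)"
    using hexagon_separation(1)[OF step] by (intro mult_left_mono) auto
  then show "2 * a\<^sup>2 \<le> D" using * by linarith
  assume "D = 2 * a\<^sup>2"
  then have "a\<^sup>2 * (1 + (cmod (z x))\<^sup>2) \<le> a\<^sup>2 * 2" using * by linarith
  then have "(cmod (z x))\<^sup>2 \<le> 1" using a by simp
  then have "z x \<in> eisenstein" using hexagon_separation(2) step by blast
  then have "z x - x \<in> eisenstein" using x(1) by simp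
  then show "cnj \<nu> / of_real a \<in> eisenstein" by (simp add: z_def)
qed


text \<open>The shift completes the square and so removes the cross term. It is a change of basis of
  the lattice once \<open>cnj \<nu> / of_real a\<close> is an Eisenstein integer.\<close>

lemma herm_complete_square_integral:
  assumes "a \<noteq> 0" "(cmod \<nu>)\<^sup>2 - a * c = 2 * a\<^sup>2"
  shows "herm a c \<nu> (x - cnj \<nu> / of_real a * y) y = a * ((cmod x)\<^sup>2 - 2 * (cmod y)\<^sup>2)"
proof -
  have "of_real a * (x - cnj \<nu> / of_real a * y) + cnj \<nu> * y = of_real a * x"
    using assms(1) by (simp add: field_simps)
  then have "a * herm a c \<nu> (x - cnj \<nu> / of_real a * y) y
      = a * (a * ((cmod x)\<^sup>2 - 2 * (cmod y)\<^sup>2))"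
    unfolding herm_complete_square assms(2)
    by (simp add: norm_mult power_mult_distrib) (simp add: power2_eq_square algebra_simps)
  then show ?thesis using assms(1) by simp
qed

lemma herm_scale:
  "herm (s * a) (s * c) (of_real s * \<nu>) x y = s * herm a c \<nu> x y"
proof -
  have "Re (of_real s * \<nu> * x * cnj y) = s * Re (\<nu> * x * cnj y)"
    by (simp add: mult.assoc)
  then show ?thesis unfolding herm_def by (simp add: algebra_simps)
qed

section \<open>The action of the general linear group\<close>

lemma hval_eq_herm:
  "hval f v = herm (of_rat (coef_a f)) (of_rat (coef_c f)) (coef_nu f) (v $ 1) (v $ 2)"
  by (simp add: hval_def herm_def algebra_simps)

lemma disc_eq: "disc f = 3 * ((cmod (coef_nu f))\<^sup>2 - of_rat (coef_a f) * of_rat (coef_c f))"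
  by (simp add: disc_def)

lemma lattice2_iff: "v \<in> lattice2 \<longleftrightarrow> v $ 1 \<in> eisenstein \<and> v $ 2 \<in> eisenstein"
  by (simp add: lattice2_def forall_2)

lemma hval_0 [simp]: "hval f 0 = 0"
  by (simp add: hval_def)

lemma matrix_vector_mult_2:
  fixes g :: "complex ^ 2 ^ 2"
  shows "(g *v w) $ 1 = g $ 1 $ 1 * w $ 1 + g $ 1 $ 2 * w $ 2"
    and "(g *v w) $ 2 = g $ 2 $ 1 * w $ 1 + g $ 2 $ 2 * w $ 2"
  by (simp_all add: matrix_vector_mult_def sum_2)

lemma GL2_lattice2: "g \<in> GL2 \<Longrightarrow> w \<in> lattice2 \<Longrightarrow> g *v w \<in> lattice2"
  by (simp add: GL2_def lattice2_iff matrix_vector_mult_2 forall_2)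

lemma GL2_inverse:
  assumes "g \<in> GL2"
  obtains h where "h \<in> GL2" "\<And>w. g *v (h *v w) = w" "\<And>w. h *v (g *v w) = w"
proof -
  obtain h where h: "\<forall>i j. h $ i $ j \<in> eisenstein" "g ** h = mat 1" "h ** g = mat 1"
    using assms by (auto simp: GL2_def)
  then have "h \<in> GL2" using assms by (auto simp: GL2_def)
  moreover have "g *v (h *v w) = w" "h *v (g *v w) = w" for w
    unfolding matrix_vector_mul_assoc h by simp_all
  ultimately show ?thesis by (rule that)
qed

lemma GL2_mult:
  assumes "g \<in> GL2" "h \<in> GL2"
  shows "g ** h \<in> GL2"
proof -
  have entries: "\<forall>i j. (p ** q) $ i $ j \<in> eisenstein"
    if "\<forall>i j. p $ i $ j \<in> eisenstein" "\<forall>i j. q $ i $ j \<in> eisenstein" for p q :: "complex ^ 2 ^ 2"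
    using that by (simp add: matrix_matrix_mult_def sum_2)
  obtain g' h' where g': "\<forall>i j. g' $ i $ j \<in> eisenstein" "g ** g' = mat 1" "g' ** g = mat 1"
    and h': "\<forall>i j. h' $ i $ j \<in> eisenstein" "h ** h' = mat 1" "h' ** h = mat 1"
    using assms by (auto simp: GL2_def)
  have "(g ** h) ** (h' ** g') = g ** (h ** h') ** g'" "(h' ** g') ** (g ** h) = h' ** (g' ** g) ** h"
    by (simp_all add: matrix_mul_assoc)
  then have "(g ** h) ** (h' ** g') = mat 1" "(h' ** g') ** (g ** h) = mat 1"
    using g' h' by simp_all
  then show ?thesis using entries assms g'(1) h'(1) unfolding GL2_def by blast
qed

lemma GL2_mat_1: "mat 1 \<in> GL2"
proof -
  have "\<forall>i j. (mat 1 :: complex ^ 2 ^ 2) $ i $ j \<in> eisenstein" by (simp add: mat_def)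
  then show ?thesis unfolding GL2_def using matrix_mul_lid by blast
qed

text \<open>The inverse is the adjugate multiplied by \<open>d\<close>, the inverse of the
  determinant.\<close>

lemma GL2_I:
  assumes "p \<in> eisenstein" "q \<in> eisenstein" "r \<in> eisenstein" "s \<in> eisenstein" "d \<in> eisenstein"
    and d: "d * (p * s - q * r) = 1"
  shows "vector [vector [p, q], vector [r, s]] \<in> GL2"
proof -
  define g h :: "complex ^ 2 ^ 2" where "g = vector [vector [p, q], vector [r, s]]"
    and "h = vector [vector [d * s, - (d * q)], vector [- (d * r), d * p]]"
  have "g ** h = mat 1" "h ** g = mat 1"
    using d by (simp_all add: g_def h_def vec_eq_iff forall_2 matrix_matrix_mult_def sum_2 mat_def
        algebra_simps)
  moreover have "\<forall>i j. g $ i $ j \<in> eisenstein" "\<forall>i j. h $ i $ j \<in> eisenstein"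
    using assms by (simp_all add: g_def h_def forall_2)
  ultimately show ?thesis unfolding GL2_def g_def[symmetric] by blast
qed

text \<open>The determinants of \<open>g\<close> and of its inverse have non-negative integer norms
  with product 1.\<close>

lemma GL2_det_norm:
  assumes "g \<in> GL2"
  shows "(cmod (g $ 1 $ 1 * g $ 2 $ 2 - g $ 1 $ 2 * g $ 2 $ 1))\<^sup>2 = 1"
proof -
  obtain h where h: "\<forall>i j. h $ i $ j \<in> eisenstein" "g ** h = mat 1"
    using assms by (auto simp: GL2_def)
  have gA: "\<forall>i j. g $ i $ j \<in> eisenstein" using assms by (auto simp: GL2_def)
  have "det g \<in> eisenstein" "det h \<in> eisenstein" using h(1) gA by (simp_all add: det_2)
  then obtain k l :: int where kl: "(cmod (det g))\<^sup>2 = of_int k" "(cmod (det h))\<^sup>2 = of_int l"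
    by (metis eisenstein_norm_Ints Ints_cases)
  have "det g * det h = 1" using h(2) by (metis det_mul det_I)
  then have "(cmod (det g))\<^sup>2 * (cmod (det h))\<^sup>2 = 1"
    by (metis norm_mult norm_one one_power2 power_mult_distrib)
  then have "k * l = 1" unfolding kl by (metis of_int_mult of_int_eq_1_iff)
  moreover have "0 \<le> k" by (metis kl(1) of_int_0_le_iff zero_le_power2)
  ultimately have "k = 1" by (simp add: zmult_eq_1_iff)
  then show ?thesis using kl(1) by (simp add: det_2)
qed

text \<open>Packages the Gram coefficients of the columns of \<open>g\<close>, so that later
  arguments see only the new form and its discriminant.\<close>

lemma hval_GL2:
  fixes g :: "complex ^ 2 ^ 2"
  obtains a c \<nu> where "\<And>w. hval f (g *v w) = herm a c \<nu> (w $ 1) (w $ 2)"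
    and "g \<in> GL2 \<Longrightarrow> 3 * ((cmod \<nu>)\<^sup>2 - a * c) = disc f"
proof (rule that)
  show "hval f (g *v w) = herm
     (herm (of_rat (coef_a f)) (of_rat (coef_c f)) (coef_nu f) (g $ 1 $ 1) (g $ 2 $ 1))
     (herm (of_rat (coef_a f)) (of_rat (coef_c f)) (coef_nu f) (g $ 1 $ 2) (g $ 2 $ 2))
     (herm_polar (of_rat (coef_a f)) (of_rat (coef_c f)) (coef_nu f)
        (g $ 1 $ 1) (g $ 2 $ 1) (g $ 1 $ 2) (g $ 2 $ 2)) (w $ 1) (w $ 2)" for w
    unfolding hval_eq_herm matrix_vector_mult_2 herm_subst ..
qed (simp add: herm_det_subst GL2_det_norm disc_eq)

section \<open>Invariants of equivalent forms\<close>

lemma equiv_GL2_equiv: "equiv herm_forms GL2_equiv"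
proof (rule equivI)
  show "GL2_equiv \<subseteq> herm_forms \<times> herm_forms" by (auto simp: GL2_equiv_def)
  show "refl_on herm_forms GL2_equiv"
    by (auto simp: refl_on_def GL2_equiv_def intro!: bexI[OF _ GL2_mat_1])
  show "sym GL2_equiv"
  proof (rule symI)
    fix f f' assume "(f, f') \<in> GL2_equiv"
    then obtain g where g: "g \<in> GL2" "\<And>w. w \<in> lattice2 \<Longrightarrow> hval f' w = hval f (g *v w)"
      and ff': "f \<in> herm_forms" "f' \<in> herm_forms" by (auto simp: GL2_equiv_def)
    obtain h where "h \<in> GL2" "\<And>w. g *v (h *v w) = w" using GL2_inverse[OF g(1)] by metis
    then show "(f', f) \<in> GL2_equiv" using g ff'
      by (auto simp: GL2_equiv_def GL2_lattice2 intro!: bexI[of _ h])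
  qed
  show "trans GL2_equiv"
  proof (rule transI)
    fix f f' f'' assume "(f, f') \<in> GL2_equiv" "(f', f'') \<in> GL2_equiv"
    then obtain g h where "g \<in> GL2" "\<And>w. w \<in> lattice2 \<Longrightarrow> hval f' w = hval f (g *v w)"
      "h \<in> GL2" "\<And>w. w \<in> lattice2 \<Longrightarrow> hval f'' w = hval f' (h *v w)"
      and "f \<in> herm_forms" "f'' \<in> herm_forms" by (auto simp: GL2_equiv_def)
    then show "(f, f'') \<in> GL2_equiv"
      by (auto simp: GL2_equiv_def GL2_lattice2 matrix_vector_mul_assoc intro!: bexI[of _ "g ** h"] GL2_mult)
  qed
qed

text \<open>Values on the lattice determine the coefficients, so those of \<open>f'\<close> are the
  transformed coefficients of \<open>f\<close>.\<close>

lemma GL2_equiv_disc: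
  assumes "(f, f') \<in> GL2_equiv"
  shows "disc f' = disc f"
proof -
  obtain g where g: "g \<in> GL2" "\<And>w. w \<in> lattice2 \<Longrightarrow> hval f' w = hval f (g *v w)"
    using assms by (auto simp: GL2_equiv_def)
  obtain a c \<nu> where F: "\<And>w. hval f (g *v w) = herm a c \<nu> (w $ 1) (w $ 2)"
    and D: "3 * ((cmod \<nu>)\<^sup>2 - a * c) = disc f" using hval_GL2[of f g] g(1) by metis
  have "herm (of_rat (coef_a f')) (of_rat (coef_c f')) (coef_nu f') x y = herm a c \<nu> x y"
    if "x \<in> eisenstein" "y \<in> eisenstein" for x y
  proof -
    have "hval f' (vector [x, y]) = herm a c \<nu> x y"
      using g(2)[of "vector [x, y]"] that by (simp add: F lattice2_iff)
    then show ?thesis by (simp add: hval_eq_herm)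
  qed
  from herm_coeffs_eqI[OF this] show ?thesis using D by (simp add: disc_eq)
qed

text \<open>The matrix \<open>g\<close> permutes the lattice and, being injective, also its non-zero
  vectors.\<close>

lemma GL2_equiv_values:
  assumes "(f, f') \<in> GL2_equiv"
  shows "hval f' ` lattice2 = hval f ` lattice2"
    and "hval f' ` (lattice2 - {0}) = hval f ` (lattice2 - {0})"
proof -
  obtain g where g: "g \<in> GL2" "\<And>w. w \<in> lattice2 \<Longrightarrow> hval f' w = hval f (g *v w)"
    using assms by (auto simp: GL2_equiv_def)
  obtain h where h: "h \<in> GL2" "\<And>w. g *v (h *v w) = w" "\<And>w. h *v (g *v w) = w"
    using GL2_inverse[OF g(1)] by metis
  have "(*v) g ` lattice2 = lattice2"
    using GL2_lattice2[OF g(1)] GL2_lattice2[OF h(1)] h(2) by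
    (metis (no_types, lifting) image_subset_iff subset_antisym subsetI rev_image_eqI)
  moreover have "(*v) g ` (lattice2 - {0}) = (*v) g ` lattice2 - (*v) g ` {0}"
    using h(3) by (intro image_set_diff) (metis injI)
  ultimately have *: "(*v) g ` lattice2 = lattice2" "(*v) g ` (lattice2 - {0}) = lattice2 - {0}"
    by simp_all
  have eq: "hval f' ` S = hval f ` ((*v) g ` S)" if "S \<subseteq> lattice2" for S
    unfolding image_image using g(2) that by (intro image_cong) auto
  show "hval f' ` lattice2 = hval f ` lattice2"
    and "hval f' ` (lattice2 - {0}) = hval f ` (lattice2 - {0})"
    using eq[of lattice2] eq[of "lattice2 - {0}"] * by simp_all
qed

text \<open>Apart from membership in \<open>herm_forms\<close>, every condition is phrased through
  the two value sets, which equivalence preserves.\<close>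

lemma admissible_forms_values:
  "f \<in> admissible_forms \<longleftrightarrow> f \<in> herm_forms \<and> hval f ` lattice2 \<subseteq> \<int> \<and>
     Gcd {n :: int. of_int n \<in> hval f ` lattice2} = 1 \<and>
     (\<exists>r\<in>hval f ` lattice2. r > 0) \<and> (\<exists>r\<in>hval f ` lattice2. r < 0) \<and>
     0 \<notin> hval f ` (lattice2 - {0})"
proof -
  have "{n :: int. \<exists>w\<in>lattice2. hval f w = of_int n} = {n. of_int n \<in> hval f ` lattice2}"
    by (auto simp: image_iff eq_commute)
  moreover have "represents_zero f \<longleftrightarrow> 0 \<in> hval f ` (lattice2 - {0})"
    unfolding represents_zero_def image_iff by (simp only: eq_commute)
  ultimately show ?thesis
    unfolding admissible_forms_def integral_form_def primitive_form_def indefinite_form_def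
    by (simp add: image_subset_iff)
qed

lemma GL2_equiv_admissible:
  assumes "(f, f') \<in> GL2_equiv" "f \<in> admissible_forms"
  shows "f' \<in> admissible_forms"
proof -
  have "f' \<in> herm_forms" using assms(1) by (simp add: GL2_equiv_def)
  then show ?thesis
    using assms(2) unfolding admissible_forms_values GL2_equiv_values[OF assms(1)] by simp
qed

section \<open>Minimal vectors\<close>

text \<open>Integrality makes the least absolute value attained, and it is positive because
  \<open>f\<close> does not represent 0.\<close>

lemma admissible_min_exists:
  assumes f: "f \<in> admissible_forms"
  obtains k :: int where "k > 0" "is_min_abs f (of_int k)"
proof -
  have int: "hval f w \<in> \<int>" if "w \<in> lattice2" for w
    using f that by (simp add: admissible_forms_def integral_form_def)
  obtain v0 where "v0 \<in> lattice2" "hval f v0 > 0"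
    using f by (auto simp: admissible_forms_def indefinite_form_def)
  then have "v0 \<in> lattice2 - {0}" by auto
  from ex_has_least_nat[where P = "\<lambda>v. v \<in> lattice2 - {0}" and m = "\<lambda>v. nat \<lfloor>\<bar>hval f v\<bar>\<rfloor>", OF this]
  obtain v where v: "v \<in> lattice2 - {0}"
    and least: "\<And>w. w \<in> lattice2 - {0} \<Longrightarrow> nat \<lfloor>\<bar>hval f v\<bar>\<rfloor> \<le> nat \<lfloor>\<bar>hval f w\<bar>\<rfloor>" by blast
  obtain k :: int where k: "hval f v = of_int k" using int v by (metis Ints_cases DiffD1)
  have "hval f v \<noteq> 0" using f v by (auto simp: admissible_forms_def represents_zero_def)
  then have "\<bar>k\<bar> > 0" using k by simp
  moreover have "is_min_abs f (of_int \<bar>k\<bar>)"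
    unfolding is_min_abs_def
  proof (intro conjI ballI)
    show "\<exists>v\<in>lattice2 - {0}. \<bar>hval f v\<bar> = of_int \<bar>k\<bar>"
      using v k by (intro bexI[of _ v]) auto
    fix w assume w: "w \<in> lattice2 - {0}"
    obtain l :: int where "hval f w = of_int l" using int w by (metis Ints_cases DiffD1)
    then show "of_int \<bar>k\<bar> \<le> \<bar>hval f w\<bar>" using least[OF w] k
      by (simp flip: of_int_abs)
  qed
  ultimately show ?thesis by (rule that)
qed

text \<open>A minimal vector is unimodular: dividing it by a non-unit would decrease the value.\<close>

lemma min_vector_basis:
  assumes m: "is_min_abs f m" "m > 0"
  obtains g where "g \<in> GL2" "\<bar>hval f (g *v vector [1, 0])\<bar> = m"
proof -
  obtain v where v: "v \<in> lattice2" "v \<noteq> 0" "\<bar>hval f v\<bar> = m" using m(1) by (auto simp: is_min_abs_def)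
  have "v $ 1 \<in> eisenstein" "v $ 2 \<in> eisenstein" "v $ 1 \<noteq> 0 \<or> v $ 2 \<noteq> 0"
    using v by (auto simp: lattice2_iff vec_eq_iff forall_2)
  then obtain d s t x y where d: "d \<noteq> 0" "d \<in> eisenstein" and st: "s \<in> eisenstein" "t \<in> eisenstein"
    and xy: "x \<in> eisenstein" "y \<in> eisenstein" "v $ 1 = d * x" "v $ 2 = d * y" "s * x + t * y = 1"
    by (rule eisenstein_bezout)
  \<comment> \<open>The Bezout relation says that this matrix has determinant 1.\<close>
  define g :: "complex ^ 2 ^ 2" where "g = vector [vector [x, - t], vector [y, s]]"
  have g: "g \<in> GL2" unfolding g_def
    by (rule GL2_I[where d = 1]) (use st xy in \<open>simp_all add: mult.commute\<close>)
  have ge: "g *v vector [1, 0] = vector [x, y]"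
    by (simp add: vec_eq_iff forall_2 matrix_vector_mult_2 g_def)
  have "hval f v = (cmod d)\<^sup>2 * hval f (vector [x, y])"
  proof -
    have "coef_nu f * (d * x) * cnj (d * y) = of_real ((cmod d)\<^sup>2) * (coef_nu f * x * cnj y)"
      unfolding complex_norm_square by (simp add: algebra_simps)
    then have "Re (coef_nu f * (d * x) * cnj (d * y)) = (cmod d)\<^sup>2 * Re (coef_nu f * x * cnj y)"
      by (simp only: Re_complex_of_real Im_complex_of_real times_complex.sel)
    then show ?thesis unfolding hval_eq_herm herm_def xy(3,4)
      by (simp add: norm_mult power_mult_distrib algebra_simps)
  qed
  then have "m = (cmod d)\<^sup>2 * \<bar>hval f (vector [x, y])\<bar>" using v(3) by (simp add: abs_mult)
  moreover have "1 \<le> (cmod d)\<^sup>2"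
  proof -
    obtain k :: int where k: "(cmod d)\<^sup>2 = of_int k" using d(2) by (metis eisenstein_norm_Ints Ints_cases)
    moreover have "(cmod d)\<^sup>2 > 0" using d(1) by simp
    ultimately show ?thesis by simp
  qed
  then have "1 * \<bar>hval f (vector [x, y])\<bar> \<le> (cmod d)\<^sup>2 * \<bar>hval f (vector [x, y])\<bar>"
    by (intro mult_right_mono) auto
  moreover have "m \<le> \<bar>hval f (vector [x, y])\<bar>"
  proof -
    have "vector [x, y] \<in> lattice2" using xy by (simp add: lattice2_iff)
    moreover have "vector [x, y] \<noteq> (0 :: complex ^ 2)"
      using xy(5) by (auto simp: vec_eq_iff forall_2)
    ultimately show ?thesis using m(1) by (auto simp: is_min_abs_def)
  qed
  ultimately have "\<bar>hval f (vector [x, y])\<bar> = m" by linarith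
  then show ?thesis using that g ge by metis
qed

text \<open>In a basis starting with a minimal vector the first coefficient is \<open>m\<close> up
  to sign. After a sign change \<open>herm_min_bound\<close> applies, with \<open>disc f\<close>
  three times its \<open>D\<close>; in the equality case it also supplies the integral shift that
  diagonalises the form.\<close>

lemma min_reduction:
  assumes f: "f \<in> admissible_forms" and m: "is_min_abs f m" "m > 0"
  shows "6 * m\<^sup>2 \<le> disc f"
    and "disc f = 6 * m\<^sup>2 \<Longrightarrow> \<exists>s\<in>{1, -1}. \<exists>g\<in>GL2. \<forall>w.
           hval f (g *v w) = s * m * ((cmod (w $ 1))\<^sup>2 - 2 * (cmod (w $ 2))\<^sup>2)"
proof -
  obtain g where g: "g \<in> GL2" "\<bar>hval f (g *v vector [1, 0])\<bar> = m"
    using min_vector_basis[OF m] by metis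
  obtain a' c' \<nu>' where F': "\<And>w. hval f (g *v w) = herm a' c' \<nu>' (w $ 1) (w $ 2)"
    and D': "3 * ((cmod \<nu>')\<^sup>2 - a' * c') = disc f" using hval_GL2[of f g] g(1) by metis
  define s :: real where "s = (if a' > 0 then 1 else -1)"
  define a c \<nu> where "a = s * a'" and "c = s * c'" and "\<nu> = of_real s * \<nu>'"
  have s: "s \<in> {1, -1}" "s * s = 1" by (auto simp: s_def)
  have "\<bar>a'\<bar> = m" using g(2) by (simp add: F' herm_def)
  then have a: "a = m" using m(2) by (auto simp: a_def s_def)
  have F: "herm a c \<nu> x y = s * hval f (g *v vector [x, y])" for x y
    by (simp add: a_def c_def \<nu>_def herm_scale F')
  have D: "3 * ((cmod \<nu>)\<^sup>2 - a * c) = disc f"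
    using D' s by (auto simp: a_def c_def \<nu>_def norm_mult power_mult_distrib)
  obtain h where h: "h \<in> GL2" "\<And>w. g *v (h *v w) = w" "\<And>w. h *v (g *v w) = w"
    using GL2_inverse[OF g(1)] by metis
  have L: "g *v vector [x, y] \<in> lattice2" if "x \<in> eisenstein" "y \<in> eisenstein" for x y
    using that by (intro GL2_lattice2[OF g(1)]) (simp add: lattice2_iff)
  have int: "herm a c \<nu> x y \<in> \<int>" if "x \<in> eisenstein" "y \<in> eisenstein" for x y
    using f L[OF that] s(1) by (auto simp: F admissible_forms_def integral_form_def)
  have min: "a \<le> \<bar>herm a c \<nu> x y\<bar>" if "x \<in> eisenstein" "y \<in> eisenstein" "x \<noteq> 0 \<or> y \<noteq> 0" for x y
  proof -
    have "vector [x, y] \<noteq> (0 :: complex ^ 2)" using that(3) by (auto simp: vec_eq_iff forall_2)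
    then have "g *v vector [x, y] \<noteq> 0" by (metis h(3) matrix_vector_mult_0_right)
    then have "m \<le> \<bar>hval f (g *v vector [x, y])\<bar>"
      using L[OF that(1,2)] m(1) by (simp add: is_min_abs_def)
    then show ?thesis unfolding F using s(1) a by (auto simp: abs_mult)
  qed
  \<comment> \<open>As \<open>f\<close> takes both signs, a negative value exists for either choice
    of \<open>s\<close>.\<close>
  obtain w where w: "s * hval f w < 0"
    using f s(1) by (auto simp: admissible_forms_def indefinite_form_def)
  have "h *v w = vector [(h *v w) $ 1, (h *v w) $ 2]" by (simp add: vec_eq_iff forall_2)
  then have neg: "herm a c \<nu> ((h *v w) $ 1) ((h *v w) $ 2) < 0"
    unfolding F using w h(2) by metis
  have a0: "a > 0" using a m(2) by simp
  note bound = herm_min_bound[OF a0 int min neg]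
  show "6 * m\<^sup>2 \<le> disc f" using bound(1) D a by simp
  assume "disc f = 6 * m\<^sup>2"
  then have D2: "(cmod \<nu>)\<^sup>2 - a * c = 2 * a\<^sup>2" using D a by simp
  define t where "t = cnj \<nu> / of_real a"
  have t: "t \<in> eisenstein" unfolding t_def using bound(2) D2 by blast
  define u :: "complex ^ 2 ^ 2" where "u = vector [vector [1, - t], vector [0, 1]]"
  have "u \<in> GL2" unfolding u_def by (rule GL2_I[where d = 1]) (use t in simp_all)
  then have "g ** u \<in> GL2" using g(1) by (intro GL2_mult)
  moreover have "hval f ((g ** u) *v w) = s * m * ((cmod (w $ 1))\<^sup>2 - 2 * (cmod (w $ 2))\<^sup>2)" for w
  proof -
    have uw: "u *v w = vector [w $ 1 - t * w $ 2, w $ 2]"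
      by (simp add: vec_eq_iff forall_2 matrix_vector_mult_2 u_def)
    have "s * hval f ((g ** u) *v w) = herm a c \<nu> (w $ 1 - t * w $ 2) (w $ 2)"
      by (simp add: F uw flip: matrix_vector_mul_assoc)
    also have "\<dots> = a * ((cmod (w $ 1))\<^sup>2 - 2 * (cmod (w $ 2))\<^sup>2)"
      unfolding t_def using a0 D2 by (intro herm_complete_square_integral) auto
    finally have "s * s * hval f ((g ** u) *v w) = s * (m * ((cmod (w $ 1))\<^sup>2 - 2 * (cmod (w $ 2))\<^sup>2))"
      using a by simp
    then show ?thesis using s(2) by simp
  qed
  ultimately show "\<exists>s\<in>{1, -1}. \<exists>g\<in>GL2. \<forall>w.
      hval f (g *v w) = s * m * ((cmod (w $ 1))\<^sup>2 - 2 * (cmod (w $ 2))\<^sup>2)"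
    using s(1) by blast
qed

section \<open>The extremal form\<close>

definition extremal_form :: herm_form where
  "extremal_form = \<lparr>coef_a = 1, coef_c = -2, coef_nu = 0\<rparr>"

lemma hval_extremal: "hval extremal_form w = (cmod (w $ 1))\<^sup>2 - 2 * (cmod (w $ 2))\<^sup>2"
  by (simp add: hval_def extremal_form_def of_rat_minus)

lemma disc_extremal: "disc extremal_form = 6"
  by (simp add: disc_def extremal_form_def of_rat_minus)

lemma extremal_form_in_herm_forms: "extremal_form \<in> herm_forms"
  unfolding herm_forms_def Q_sqrt_m3_def extremal_form_def
  by (auto intro!: exI[of _ "0 :: rat"])

text \<open>The prime 2 is inert: \<open>2\<close> divides \<open>p\<^sup>2 + p q + q\<^sup>2\<close> only if it divides \<open>p\<close> and \<open>q\<close>.\<close>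

lemma eisenstein_norm_ne_double:
  assumes "x \<in> eisenstein" "y \<in> eisenstein" "(cmod x)\<^sup>2 = 2 * (cmod y)\<^sup>2"
  shows "x = 0"
proof -
  have descent: "p = 0 \<and> q = 0" if "p\<^sup>2 + p * q + q\<^sup>2 = 2 * (r\<^sup>2 + r * s + s\<^sup>2)" for p q r s :: int
    using that
  proof (induction "nat (p\<^sup>2 + p * q + q\<^sup>2)" arbitrary: p q r s rule: less_induct)
    case less
    have "even (p\<^sup>2 + p * q + q\<^sup>2)" using less.prems by simp
    then have "even p" "even q" by auto
    then obtain p' q' where pq: "p = 2 * p'" "q = 2 * q'" by (auto elim!: evenE)
    \<comment> \<open>Cancelling a factor 2 exchanges the pairs: (r, s) moves to the left with half
      the norm, ready for the induction hypothesis.\<close>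
    have eq: "r\<^sup>2 + r * s + s\<^sup>2 = 2 * (p'\<^sup>2 + p' * q' + q'\<^sup>2)"
      using less.prems by (simp add: pq power2_eq_square)
    have pos: "0 \<le> r\<^sup>2 + r * s + s\<^sup>2"
      using eisenstein_norm_int[of r s] by (metis of_int_0_le_iff zero_le_power2)
    show ?case
    proof (cases "r\<^sup>2 + r * s + s\<^sup>2 = 0")
      case True
      then have "(cmod (of_int p + of_int q * rho))\<^sup>2 = 0"
        unfolding eisenstein_norm_int using less.prems by simp
      then show ?thesis by (simp add: complex_eq_iff rho_eq)
    next
      case False
      then have "nat (r\<^sup>2 + r * s + s\<^sup>2) < nat (p\<^sup>2 + p * q + q\<^sup>2)" using pos less.prems by simp
      from less.hyps[OF this eq] False show ?thesis by simp
    qed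
  qed
  obtain p q r s :: int where xy: "x = of_int p + of_int q * rho" "y = of_int r + of_int s * rho"
    using assms(1,2) unfolding eisenstein_eq by blast
  have "real_of_int (p\<^sup>2 + p * q + q\<^sup>2) = of_int (2 * (r\<^sup>2 + r * s + s\<^sup>2))"
    using assms(3) unfolding xy eisenstein_norm_int by simp
  then show ?thesis using descent[of p q r s] by (simp only: of_int_eq_iff) (simp add: xy)
qed

lemma extremal_form_admissible: "extremal_form \<in> admissible_forms"
proof -
  have e: "vector [1, 0] \<in> lattice2" "vector [0, 1] \<in> lattice2" by (simp_all add: lattice2_iff)
  have v: "hval extremal_form (vector [1, 0]) = 1" "hval extremal_form (vector [0, 1]) = -2"
    by (simp_all add: hval_extremal)
  have "integral_form extremal_form"
    by (auto simp: integral_form_def hval_extremal lattice2_iff intro!: Ints_diff Ints_mult eisenstein_norm_Ints)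
  moreover have "primitive_form extremal_form"
  proof -
    have "1 \<in> {n :: int. \<exists>w\<in>lattice2. hval extremal_form w = of_int n}" using e(1) v(1) by auto
    then show ?thesis unfolding primitive_form_def by (rule Gcd_eq_1_I[rotated]) simp
  qed
  moreover have "indefinite_form extremal_form"
    unfolding indefinite_form_def using e v
    by (intro conjI bexI[of _ "vector [1, 0]"] bexI[of _ "vector [0, 1]"]) simp_all
  moreover have "\<not> represents_zero extremal_form"
  proof
    assume "represents_zero extremal_form"
    then obtain w where w: "w \<in> lattice2" "w \<noteq> 0" "hval extremal_form w = 0"
      by (auto simp: represents_zero_def)
    then have "w $ 1 = 0" by (intro eisenstein_norm_ne_double[of _ "w $ 2"]) (auto simp: lattice2_iff hval_extremal)
    then show False using w by (auto simp: hval_extremal vec_eq_iff forall_2)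
  qed
  ultimately show ?thesis using extremal_form_in_herm_forms by (simp add: admissible_forms_def)
qed

lemma min_equality_imp_equiv:
  assumes f: "f \<in> admissible_forms" and m: "is_min_abs f (of_int k)" "k > 0"
    and eq: "disc f = 6 * (of_int k)\<^sup>2"
  shows "(extremal_form, f) \<in> GL2_equiv"
proof -
  obtain s :: real and g where s: "s \<in> {1, -1}" and g: "g \<in> GL2"
    and F: "\<And>w. hval f (g *v w) = s * of_int k * ((cmod (w $ 1))\<^sup>2 - 2 * (cmod (w $ 2))\<^sup>2)"
    using min_reduction(2)[OF f m(1) _ eq] m(2) of_int_0_less_iff by blast
  obtain h where h: "h \<in> GL2" "\<And>w. g *v (h *v w) = w" using GL2_inverse[OF g] by metis
  \<comment> \<open>Up to sign every value of \<open>f\<close> is \<open>k\<close> times a value of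
    the extremal form; primitivity then leaves \<open>k = 1\<close>.\<close>
  have "k dvd n" if n: "w \<in> lattice2" "hval f w = of_int n" for n w
  proof -
    have "hval extremal_form (h *v w) \<in> \<int>"
      using GL2_lattice2[OF h(1) n(1)] extremal_form_admissible
      by (simp add: admissible_forms_def integral_form_def)
    then obtain l :: int where l: "hval extremal_form (h *v w) = of_int l" by (auto elim: Ints_cases)
    have "of_int n = s * of_int k * of_int l"
      using F[of "h *v w"] n(2) h(2) l by (simp add: hval_extremal)
    then have "real_of_int n = of_int (k * l) \<or> real_of_int n = of_int (- (k * l))" using s by auto
    then show ?thesis by (simp only: of_int_eq_iff) auto
  qed
  then have "k dvd Gcd {n :: int. \<exists>w\<in>lattice2. hval f w = of_int n}"
    by (intro Gcd_greatest) auto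
  then have "k = 1" using f m(2) by (simp add: admissible_forms_def primitive_form_def)
  have "\<exists>u\<in>GL2. \<forall>w. hval f (u *v w) = hval extremal_form w"
  proof (cases "s = 1")
    case True
    then show ?thesis using g F \<open>k = 1\<close> by (auto simp: hval_extremal)
  next
    case False
    then have "s = -1" using s by simp
    \<comment> \<open>The extremal form is equivalent to its negative.\<close>
    define u :: "complex ^ 2 ^ 2" where "u = vector [vector [1, 2], vector [1, 1]]"
    have "u \<in> GL2" unfolding u_def by (rule GL2_I[where d = "-1"]) simp_all
    then have "g ** u \<in> GL2" using g by (intro GL2_mult)
    \<comment> \<open>The cross terms cancel in N(x + 2y) - 2 N(x + y) = 2 N(y) - N(x).\<close>
    moreover have "hval f ((g ** u) *v w) = hval extremal_form w" for w
      unfolding matrix_vector_mul_assoc[symmetric] F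
      by (simp add: \<open>s = -1\<close> \<open>k = 1\<close> hval_extremal matrix_vector_mult_2 u_def cmod_power2)
         (simp add: power2_eq_square algebra_simps)
    ultimately show ?thesis by blast
  qed
  then have "(f, extremal_form) \<in> GL2_equiv"
    using f extremal_form_in_herm_forms unfolding GL2_equiv_def admissible_forms_def
    by (simp add: Bex_def) metis
  then show ?thesis using equiv_GL2_equiv by (auto simp: equiv_def dest: symD)
qed

section \<open>The bound and the case of equality\<close>

lemma is_min_abs_unique: "is_min_abs f m \<Longrightarrow> is_min_abs f m' \<Longrightarrow> m = m'"
  unfolding is_min_abs_def by (metis order_antisym)

theorem theorem8p7:
  shows "(\<forall>f\<in>admissible_forms. \<exists>v\<in>lattice2 - {0}. \<bar>hval f v\<bar> \<le> sqrt (disc f / 6)) \<and>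
    (\<exists>C. {f \<in> admissible_forms. disc f = 6} // GL2_equiv = {C} \<and>
         {f \<in> admissible_forms. is_min_abs f (sqrt (disc f / 6))} = C)"
proof -
  have bound: "\<exists>k > 0. is_min_abs f (of_int k) \<and> 6 * (of_int k)\<^sup>2 \<le> disc f"
    if "f \<in> admissible_forms" for f
    using admissible_min_exists[OF that] min_reduction(1)[OF that] by (metis of_int_0_less_iff)
  have "\<exists>v\<in>lattice2 - {0}. \<bar>hval f v\<bar> \<le> sqrt (disc f / 6)" if f: "f \<in> admissible_forms" for f
  proof -
    obtain k :: int where k: "k > 0" "is_min_abs f (of_int k)" "6 * (of_int k)\<^sup>2 \<le> disc f"
      using bound[OF f] by blast
    have "of_int k \<le> sqrt (disc f / 6)" using k(3) by (intro real_le_rsqrt) simp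
    then show ?thesis using k(2) unfolding is_min_abs_def by metis
  qed
  moreover
  define C where "C = GL2_equiv `` {extremal_form}"
  have C_sub: "f \<in> admissible_forms \<and> disc f = 6" if "f \<in> C" for f
    using that GL2_equiv_admissible extremal_form_admissible GL2_equiv_disc disc_extremal
    by (auto simp: C_def)
  have min6: "is_min_abs f (sqrt (disc f / 6))" if f: "f \<in> admissible_forms" "disc f = 6" for f
  proof -
    obtain k :: int where k: "k > 0" "is_min_abs f (of_int k)" "6 * (of_int k)\<^sup>2 \<le> disc f"
      using bound[OF f(1)] by blast
    \<comment> \<open>For discriminant 6 the bound leaves only \<open>k = 1\<close>, which is the
      square root of 6 / 6.\<close>
    have "real_of_int (k\<^sup>2) \<le> of_int 1" using k(3) f(2) by simp
    then have "k\<^sup>2 \<le> 1" by (simp only: of_int_le_iff)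
    then have "k = 1" using k(1) by (simp add: power2_eq_square) (smt (verit) mult_less_cancel_left1)
    then show ?thesis using k(2) f(2) by simp
  qed
  have min_C: "f \<in> C" if f: "f \<in> admissible_forms" "is_min_abs f (sqrt (disc f / 6))" for f
  proof -
    obtain k :: int where k: "k > 0" "is_min_abs f (of_int k)" "6 * (of_int k)\<^sup>2 \<le> disc f"
      using bound[OF f(1)] by blast
    have "0 \<le> disc f" using k(3) by (smt (verit) zero_le_power2)
    moreover have "of_int k = sqrt (disc f / 6)" using is_min_abs_unique[OF k(2) f(2)] .
    ultimately have "disc f = 6 * (of_int k)\<^sup>2" by simp
    then show ?thesis using min_equality_imp_equiv[OF f(1) k(2,1)] by (simp add: C_def)
  qed
  \<comment> \<open>The inclusions form a cycle: members of \<open>C\<close> have discriminant 6,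
    such forms attain equality, and forms attaining equality lie in \<open>C\<close>.\<close>
  have "{f \<in> admissible_forms. disc f = 6} = C" using C_sub min6 min_C by blast
  moreover have "C // GL2_equiv = {C}"
  proof -
    have "GL2_equiv `` {f} = C" if "f \<in> C" for f
      using that equiv_class_eq[OF equiv_GL2_equiv] by (auto simp: C_def)
    moreover have "extremal_form \<in> C"
      using equiv_class_self[OF equiv_GL2_equiv extremal_form_in_herm_forms] by (simp add: C_def)
    ultimately show ?thesis by (auto simp: quotient_def)
  qed
  moreover have "{f \<in> admissible_forms. is_min_abs f (sqrt (disc f / 6))} = C"
    using C_sub min6 min_C by blast
  ultimately show ?thesis by auto
qed

end
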